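(* For every $q,k\in\mathbb{N}$ and $\theta<\infty$ there exist $\zeta<\infty$ and $\epsilon_0>0$ such that the following holds. For every $m,b\in\mathbb{N}$, every $g:\mathbb{Z}_q^{m\times k}\to\mathbb{C}$ with $\|g\|_1=1$, and every $h\in\mathbb{N}$ with $h<\theta b$ and $\log_q(\|g\|_\infty)\le b\le\epsilon_0 km$, we have \[\sum_{U\in\mathcal{U}_q^{m,k}(h)}|\hat g(U)|\le\Big(\frac{\zeta\sqrt{bm}}{h}\Big)^{h/2}.\]
   Context: $\omega=e^{2\pi i/q}$; for $g:\mathbb{Z}_q^{m\times k}\to\mathbb{C}$, $\hat g(U)=\mathbb{E}_{X}[g(X)\omega^{-\langle U,X\rangle}]$ with $X$ uniform on $\mathbb{Z}_q^{m\times k}$; $\|g\|_p=(\mathbb{E}_X|g(X)|^p)^{1/p}$, $\|g\|_\infty=\max|g|$. $\mathrm{wt}(U)$ is the number of nonzero entries of $U$. $\mathcal{U}_q^{m,k}(h)$ is the set of $U\in\mathbb{Z}_q^{m\times k}$ with $\mathrm{wt}(U)=h$ such that no row of $U$ has exactly one nonzero entry (singleton-free). *)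

theory Defs
  imports "HOL-Analysis.Analysis"
begin

text \<open>
  Elements of \<open>\<int>\<^sub>q\<close> are represented by their least residues \<open>{..<q}\<close>, and matrices over
  \<open>\<int>\<^sub>q\<close> by extensional functions on index pairs, so that distinct elements of \<open>zmats q m k\<close>
  are distinct matrices.
\<close>

type_synonym zmat = "nat \<times> nat \<Rightarrow> nat"

definition zmats :: "nat \<Rightarrow> nat \<Rightarrow> nat \<Rightarrow> zmat set" where
  "zmats q m k = ({..<m} \<times> {..<k}) \<rightarrow>\<^sub>E {..<q}"

definition expect :: "nat \<Rightarrow> nat \<Rightarrow> nat \<Rightarrow> (zmat \<Rightarrow> 'a) \<Rightarrow> 'a::real_normed_field" where
  "expect q m k f = (\<Sum>X\<in>zmats q m k. f X) / of_nat (card (zmats q m k))"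

definition omega :: "nat \<Rightarrow> complex" where
  "omega q = exp (2 * of_real pi * \<i> / of_nat q)"

text \<open>
  The inner product is not reduced modulo \<open>q\<close>; it only occurs as an exponent of \<open>omega q\<close>,
  which depends on its residue class alone.
\<close>

definition mat_inner :: "nat \<Rightarrow> nat \<Rightarrow> zmat \<Rightarrow> zmat \<Rightarrow> nat" where
  "mat_inner m k U X = (\<Sum>i<m. \<Sum>j<k. U (i, j) * X (i, j))"

definition fourier :: "nat \<Rightarrow> nat \<Rightarrow> nat \<Rightarrow> (zmat \<Rightarrow> complex) \<Rightarrow> zmat \<Rightarrow> complex" where
  "fourier q m k g U = expect q m k (\<lambda>X. g X * omega q powi (- int (mat_inner m k U X)))"

definition Lp_norm :: "real \<Rightarrow> nat \<Rightarrow> nat \<Rightarrow> nat \<Rightarrow> (zmat \<Rightarrow> complex) \<Rightarrow> real" where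
  "Lp_norm p q m k g = (expect q m k (\<lambda>X. cmod (g X) powr p)) powr (1 / p)"

definition Linf_norm :: "nat \<Rightarrow> nat \<Rightarrow> nat \<Rightarrow> (zmat \<Rightarrow> complex) \<Rightarrow> real" where
  "Linf_norm q m k g = Max ((\<lambda>X. cmod (g X)) ` zmats q m k)"

definition wt :: "nat \<Rightarrow> nat \<Rightarrow> zmat \<Rightarrow> nat" where
  "wt m k U = card {(i, j). i < m \<and> j < k \<and> U (i, j) \<noteq> 0}"

definition singleton_free :: "nat \<Rightarrow> nat \<Rightarrow> nat \<Rightarrow> nat \<Rightarrow> zmat set" where
  "singleton_free q m k h =
     {U \<in> zmats q m k. wt m k U = h \<and> (\<forall>i<m. card {j. j < k \<and> U (i, j) \<noteq> 0} \<noteq> 1)}"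

end

theory Submission
  imports Defs
begin

text \<open>
  The sum of the \<open>|fourier q m k g U|\<close> is the mean of \<open>g F\<close>, where \<open>F\<close> is a combination of the
  singleton-free characters with coefficients of modulus at most 1. Jensen's inequality with
  weight \<open>|g|\<close> bounds the \<open>2s\<close>-th power of this mean by \<open>q\<^sup>b\<close> times the \<open>2s\<close>-th moment of \<open>F\<close>.
  That moment is at most the number of \<open>2s\<close>-tuples of matrices in which no position is
  nonzero in exactly one matrix. In such a tuple every occupied row carries at least
  two columns of at least two nonzero entries each, so at most \<open>s h / 2\<close> rows are occupied
  altogether, and each matrix occupies at most \<open>h / 2\<close> of them. Counting the choices of rows
  and taking \<open>s\<close> of order \<open>b / h\<close> gives the bound.
\<close>

section \<open>Means over matrices and roots of unity\<close>

lemma finite_zmats [simp]: "finite (zmats q m k)"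
  by (simp add: zmats_def finite_PiE)

lemma card_zmats: "card (zmats q m k) = q ^ (m * k)"
  by (simp add: zmats_def card_PiE)

lemma zmats_nonempty: "q \<ge> 2 \<Longrightarrow> zmats q m k \<noteq> {}"
  by (auto simp: zmats_def PiE_eq_empty_iff lessThan_empty_iff)

lemma zmats_less: "X \<in> zmats q m k \<Longrightarrow> p \<in> {..<m} \<times> {..<k} \<Longrightarrow> X p < q"
  by (auto simp: zmats_def PiE_iff)

lemma norm_expect_le:
  fixes f :: "zmat \<Rightarrow> 'a::real_normed_field"
  shows "norm (expect q m k f) \<le> expect q m k (\<lambda>X. norm (f X))"
  unfolding expect_def by (simp add: norm_divide divide_right_mono norm_sum)

lemma expect_mono:
  fixes f g :: "zmat \<Rightarrow> real"
  assumes "\<And>X. X \<in> zmats q m k \<Longrightarrow> f X \<le> g X"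
  shows "expect q m k f \<le> expect q m k g"
  unfolding expect_def using assms by (intro divide_right_mono sum_mono) auto

lemma omega_nonzero [simp]: "omega q \<noteq> 0"
  by (simp add: omega_def)

lemma norm_omega [simp]: "cmod (omega q) = 1"
proof -
  have "omega q = exp (\<i> * of_real (2 * pi / real q))"
    by (simp add: omega_def field_simps)
  then show ?thesis by (metis norm_exp_i_times)
qed

lemma cnj_omega: "cnj (omega q) = inverse (omega q)"
  by (simp add: omega_def exp_cnj flip: exp_minus)

lemma norm_omega_powi [simp]: "cmod (omega q powi n) = 1"
  by (simp add: norm_power_int)

lemma omega_powi: "omega q powi n = exp (of_int n * (2 * of_real pi * \<i> / of_nat q))"
  by (simp add: omega_def exp_power_int)

lemma omega_powi_eq_1D:
  assumes "q > 0" "omega q powi n = 1"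
  shows "int q dvd n"
proof -
  obtain l :: int where "Im (of_int n * (2 * of_real pi * \<i> / of_nat q)) = of_int (2 * l) * pi"
    using assms(2) unfolding omega_powi exp_eq_1 by auto
  then have "real_of_int n = real_of_int l * real q"
    using assms(1) by (simp add: field_simps)
  then have "real_of_int n = real_of_int (l * int q)" by simp
  then have "n = l * int q" by linarith
  then show ?thesis by simp
qed

lemma omega_powi_power_q:
  assumes "q > 0"
  shows "(omega q powi n) ^ q = 1"
proof -
  have "omega q ^ q = 1"
    using assms by (simp add: omega_def flip: exp_of_nat_mult)
  then show ?thesis
    by (metis power_int_power power_int_power' power_int_1_left power_int_mult mult.commute power_int_of_nat)
qed

lemma sum_omega_powi_eq_0:
  assumes "q > 0" "\<not> int q dvd n"
  shows "(\<Sum>x<q. (omega q powi n) ^ x) = 0"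
  using assms omega_powi_eq_1D[of q n] omega_powi_power_q[of q n]
  by (subst geometric_sum) auto

lemma powi_sum:
  fixes z :: "'a::field"
  assumes "z \<noteq> 0"
  shows "z powi (\<Sum>i\<in>A. f i) = (\<Prod>i\<in>A. z powi f i)"
  using assms by (induction A rule: infinite_finite_induct) (auto simp: power_int_add)

text \<open>The sum over all matrices factors over the positions. The factor at \<open>p\<close> is
  a full geometric sum of a \<open>q\<close>-th root of unity other than 1, so it vanishes.\<close>

lemma expect_character_eq_0:
  fixes n :: "nat \<times> nat \<Rightarrow> int"
  assumes "q > 0" "p \<in> {..<m} \<times> {..<k}" "\<not> int q dvd n p"
  shows "expect q m k (\<lambda>X. omega q powi (\<Sum>p\<in>{..<m} \<times> {..<k}. n p * int (X p))) = 0"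
proof -
  have "(\<Sum>X\<in>zmats q m k. omega q powi (\<Sum>p\<in>{..<m} \<times> {..<k}. n p * int (X p)))
      = (\<Sum>X\<in>zmats q m k. \<Prod>p\<in>{..<m} \<times> {..<k}. (omega q powi n p) ^ X p)"
    by (simp add: powi_sum power_int_mult)
  also have "\<dots> = (\<Prod>p\<in>{..<m} \<times> {..<k}. \<Sum>x<q. (omega q powi n p) ^ x)"
    unfolding zmats_def by (subst prod_sum_PiE) auto
  also have "\<dots> = 0"
    using assms sum_omega_powi_eq_0 by (intro prod_zero) auto
  finally show ?thesis by (simp add: expect_def)
qed

section \<open>Even moments of combinations of characters\<close>

lemma mat_inner_altdef: "mat_inner m k U X = (\<Sum>p\<in>{..<m} \<times> {..<k}. U p * X p)"
  by (simp add: mat_inner_def sum.cartesian_product)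

text \<open>The tuples of matrices whose characters, with arbitrary signs, can have a nonzero mean.\<close>

definition balanced_tuples :: "nat \<Rightarrow> nat \<Rightarrow> nat \<Rightarrow> zmat set \<Rightarrow> (nat \<Rightarrow> zmat) set" where
  "balanced_tuples m k n S =
     {t \<in> {..<n} \<rightarrow>\<^sub>E S. \<forall>p\<in>{..<m} \<times> {..<k}. card {i. i < n \<and> t i p \<noteq> 0} \<noteq> 1}"

text \<open>A product of characters is again a character, whose coefficient at each position is a
  signed sum of entries. Where exactly one matrix is nonzero, nothing can cancel: the coefficient is
  plus or minus a residue strictly between 0 and \<open>q\<close>. The signs \<open>e\<close> allow
  for conjugated characters.\<close>

lemma expect_tuple_eq_0:
  fixes e :: "nat \<Rightarrow> int"
  assumes q: "q > 0" and S: "S \<subseteq> zmats q m k" and e: "\<And>i. \<bar>e i\<bar> = 1"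
    and t: "t \<in> {..<n} \<rightarrow>\<^sub>E S" "t \<notin> balanced_tuples m k n S"
  shows "expect q m k (\<lambda>X. \<Prod>i<n. omega q powi (e i * int (mat_inner m k (t i) X))) = 0"
proof -
  let ?P = "{..<m} \<times> {..<k}"
  obtain p where p: "p \<in> ?P" "card {i. i < n \<and> t i p \<noteq> 0} = 1"
    using t by (auto simp: balanced_tuples_def)
  then obtain i where i: "{i. i < n \<and> t i p \<noteq> 0} = {i}"
    using card_1_singletonE by blast
  define N where "N = (\<lambda>p. \<Sum>i<n. e i * int (t i p))"
  have "N p = (\<Sum>i\<in>{i}. e i * int (t i p))"
    unfolding N_def using i by (intro sum.mono_neutral_right) auto
  then have N: "N p = e i * int (t i p)" by simp
  have "t i \<in> zmats q m k" "t i p \<noteq> 0" using i t S by auto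
  then have lt: "0 < t i p" "t i p < q" using zmats_less p by auto
  have "\<not> int q dvd N p"
  proof
    assume "int q dvd N p"
    then have "int q dvd \<bar>e i * int (t i p)\<bar>" using N by simp
    then have "q dvd t i p" by (simp add: abs_mult e)
    then show False using lt nat_dvd_not_less by blast
  qed
  moreover have "(\<Prod>i<n. omega q powi (e i * int (mat_inner m k (t i) X)))
      = omega q powi (\<Sum>p\<in>?P. N p * int (X p))" for X
    unfolding N_def mat_inner_altdef
    by (simp add: sum_distrib_left sum_distrib_right sum.swap[of _ ?P] mult.assoc flip: powi_sum)
  ultimately show ?thesis
    using expect_character_eq_0[of q p m k N] q p by simp
qed

text \<open>The power is expanded as \<open>s\<close> copies of the sum times \<open>s\<close>
  copies of its conjugate, one term for each tuple of length \<open>2 * s\<close>. Taking means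
  kills every unbalanced tuple, and each remaining term has modulus at most 1.\<close>

lemma expect_moment_le:
  fixes c :: "zmat \<Rightarrow> complex"
  assumes q: "q > 0" and S: "S \<subseteq> zmats q m k" and c: "\<And>U. cmod (c U) \<le> 1"
  shows "expect q m k (\<lambda>X. cmod (\<Sum>U\<in>S. c U * omega q powi (- int (mat_inner m k U X))) ^ (2 * s))
      \<le> real (card (balanced_tuples m k (2 * s) S))"
proof -
  define F where "F = (\<lambda>X. \<Sum>U\<in>S. c U * omega q powi (- int (mat_inner m k U X)))"
  \<comment> \<open>The first \<open>s\<close> factors come from \<open>F\<close>, whose characters
    have negative exponent; the others come from its conjugate, which reverses the sign and
    conjugates the coefficients.\<close>
  define e where "e = (\<lambda>i. if i < s then - 1 else (1 :: int))"
  define d where "d = (\<lambda>i U. if i < s then c U else cnj (c U))"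
  define \<psi> where "\<psi> = (\<lambda>t X. \<Prod>i<2 * s. omega q powi (e i * int (mat_inner m k (t i) X)))"
  define D where "D = (\<lambda>t. \<Prod>i<2 * s. d i (t i))"
  have finS: "finite S" using S finite_zmats finite_subset by blast
  have cnjF: "cnj (F X) = (\<Sum>U\<in>S. cnj (c U) * omega q powi (int (mat_inner m k U X)))" for X
    by (simp add: F_def cnj_omega power_int_minus power_inverse)
  have "complex_of_real (cmod (F X) ^ (2 * s)) = (\<Sum>t\<in>{..<2 * s} \<rightarrow>\<^sub>E S. D t * \<psi> t X)" for X
  proof -
    have "complex_of_real (cmod (F X) ^ (2 * s)) = F X ^ s * cnj (F X) ^ s"
      by (simp only: power_mult of_real_power[of "(cmod (F X))\<^sup>2"] complex_norm_square power_mult_distrib)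
    also have "\<dots> = (\<Prod>i<2 * s. if i < s then F X else cnj (F X))"
    proof -
      have "(\<Prod>i<2 * s. if i < s then F X else cnj (F X))
        = (\<Prod>i\<in>{..<s} \<union> {s..<2 * s}. if i < s then F X else cnj (F X))"
        by (rule prod.cong) auto
      also have "\<dots> = F X ^ s * cnj (F X) ^ s"
        by (subst prod.union_disjoint) auto
      finally show ?thesis ..
    qed
    also have "\<dots> = (\<Prod>i<2 * s. \<Sum>U\<in>S. d i U * omega q powi (e i * int (mat_inner m k U X)))"
      by (intro prod.cong refl) (unfold cnjF, auto simp: F_def d_def e_def)
    also have "\<dots> = (\<Sum>t\<in>{..<2 * s} \<rightarrow>\<^sub>E S. D t * \<psi> t X)"
      using finS by (subst prod_sum_PiE) (auto simp: prod.distrib D_def \<psi>_def)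
    finally show ?thesis .
  qed
  then have "complex_of_real (expect q m k (\<lambda>X. cmod (F X) ^ (2 * s)))
      = expect q m k (\<lambda>X. \<Sum>t\<in>{..<2 * s} \<rightarrow>\<^sub>E S. D t * \<psi> t X)"
    by (simp add: expect_def)
  also have "\<dots> = (\<Sum>t\<in>{..<2 * s} \<rightarrow>\<^sub>E S. D t * expect q m k (\<psi> t))"
    by (simp add: expect_def sum.swap[of _ "zmats q m k"] sum_divide_distrib sum_distrib_left)
  also have "\<dots> = (\<Sum>t\<in>balanced_tuples m k (2 * s) S. D t * expect q m k (\<psi> t))"
  proof (intro sum.mono_neutral_right ballI)
    fix t assume "t \<in> ({..<2 * s} \<rightarrow>\<^sub>E S) - balanced_tuples m k (2 * s) S"
    then have "expect q m k (\<psi> t) = 0"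
      unfolding \<psi>_def using q S by (intro expect_tuple_eq_0) (auto simp: e_def)
    then show "D t * expect q m k (\<psi> t) = 0" by simp
  qed (use finS in \<open>auto simp: balanced_tuples_def finite_PiE\<close>)
  finally have eq: "complex_of_real (expect q m k (\<lambda>X. cmod (F X) ^ (2 * s)))
      = (\<Sum>t\<in>balanced_tuples m k (2 * s) S. D t * expect q m k (\<psi> t))" .
  have le1: "cmod (D t * expect q m k (\<psi> t)) \<le> 1" for t
  proof -
    have "cmod (D t) \<le> 1"
      unfolding D_def using c by (auto simp: d_def intro!: prod_le_1 simp flip: prod_norm)
    moreover have "cmod (expect q m k (\<psi> t)) \<le> expect q m k (\<lambda>X. cmod (\<psi> t X))"
      by (rule norm_expect_le)
    moreover have "expect q m k (\<lambda>X. cmod (\<psi> t X)) = 1"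
      using q by (simp add: expect_def \<psi>_def card_zmats flip: prod_norm)
    ultimately show ?thesis by (simp add: norm_mult mult_le_one)
  qed
  have "expect q m k (\<lambda>X. cmod (F X) ^ (2 * s)) \<le> cmod (complex_of_real (expect q m k (\<lambda>X. cmod (F X) ^ (2 * s))))"
    by simp
  also have "\<dots> \<le> (\<Sum>t\<in>balanced_tuples m k (2 * s) S. 1)"
    unfolding eq using le1 by (intro sum_norm_le) auto
  finally show ?thesis by (simp add: F_def)
qed

section \<open>Counting row sets and balanced tuples\<close>

text \<open>An exponential weight replaces binomial estimates: each counted \<open>R\<close> has
  \<open>z ^ n \<le> (z\<^sup>2) ^ card R\<close>, and summing the right side over all subsets gives
  a binomial power. The free parameter \<open>z\<close> is tuned separately in the two applications,
  to row sets of single matrices and of whole tuples.\<close>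

lemma card_small_subsets_le:
  fixes z :: real
  assumes "finite A" "0 < z" "z \<le> 1"
  shows "real (card {R. R \<subseteq> A \<and> 2 * card R \<le> n}) * z ^ n \<le> exp (z\<^sup>2 * real (card A))"
proof -
  let ?P = "{R. R \<subseteq> A \<and> 2 * card R \<le> n}"
  have "real (card ?P) * z ^ n = (\<Sum>R\<in>?P. z ^ n)" by simp
  also have "\<dots> \<le> (\<Sum>R\<in>?P. (z\<^sup>2) ^ card R)"
    using assms by (intro sum_mono) (auto simp flip: power_mult intro!: power_decreasing)
  also have "\<dots> \<le> (\<Sum>R\<in>Pow A. (z\<^sup>2) ^ card R)"
    using assms by (intro sum_mono2) auto
  also have "\<dots> = (z\<^sup>2 + 1) ^ card A"
    using prod_add[OF assms(1), of "\<lambda>_. z\<^sup>2" "\<lambda>_. 1"] by simp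
  also have "\<dots> \<le> exp (z\<^sup>2) ^ card A"
    by (intro power_mono) (auto simp: exp_ge_add_one_self add.commute)
  finally show ?thesis by (simp add: exp_of_nat2_mult)
qed

definition supp_rows :: "nat \<Rightarrow> nat \<Rightarrow> zmat \<Rightarrow> nat set" where
  "supp_rows m k U = {i. i < m \<and> (\<exists>j<k. U (i, j) \<noteq> 0)}"

lemma supp_rows_subset: "supp_rows m k U \<subseteq> {..<m}"
  by (auto simp: supp_rows_def)

lemma finite_supp_rows [simp]: "finite (supp_rows m k U)"
  by (rule finite_subset[OF supp_rows_subset finite_lessThan])

lemma wt_eq_sum: "wt m k U = (\<Sum>i<m. card {j. j < k \<and> U (i, j) \<noteq> 0})"
proof -
  have "{(i, j). i < m \<and> j < k \<and> U (i, j) \<noteq> 0} = (SIGMA i:{..<m}. {j. j < k \<and> U (i, j) \<noteq> 0})"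
    by auto
  then show ?thesis by (simp add: wt_def)
qed

lemma card_supp_row_ge_2:
  assumes "U \<in> singleton_free q m k h" "i \<in> supp_rows m k U"
  shows "card {j. j < k \<and> U (i, j) \<noteq> 0} \<ge> 2"
proof -
  have "card {j. j < k \<and> U (i, j) \<noteq> 0} \<noteq> 0" "card {j. j < k \<and> U (i, j) \<noteq> 0} \<noteq> 1"
    using assms by (auto simp: supp_rows_def singleton_free_def)
  then show ?thesis by linarith
qed

lemma card_supp_rows_le:
  assumes "U \<in> singleton_free q m k h"
  shows "2 * card (supp_rows m k U) \<le> h"
proof -
  have "2 * card (supp_rows m k U) = (\<Sum>i\<in>supp_rows m k U. 2)" by simp
  also have "\<dots> \<le> (\<Sum>i\<in>supp_rows m k U. card {j. j < k \<and> U (i, j) \<noteq> 0})"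
    by (intro sum_mono card_supp_row_ge_2[OF assms])
  also have "\<dots> \<le> wt m k U"
    unfolding wt_eq_sum by (intro sum_mono2) (auto simp: supp_rows_def)
  finally show ?thesis using assms by (simp add: singleton_free_def)
qed

text \<open>Double counting of the \<open>n * h\<close> nonzero entries of the tuple. In an occupied
  row, singleton-freeness of one matrix supplies two columns, and balance supplies a second nonzero
  entry in each of them, so the row absorbs at least four entries.\<close>

lemma card_Union_supp_rows_le:
  assumes t: "t \<in> balanced_tuples m k n (singleton_free q m k h)"
  shows "4 * card (\<Union>i<n. supp_rows m k (t i)) \<le> n * h"
proof -
  define T where "T = (\<Union>i<n. supp_rows m k (t i))"
  define J where "J = (\<lambda>i a. {j. j < k \<and> t i (a, j) \<noteq> 0})"
  define I where "I = (\<lambda>a j. {i. i < n \<and> t i (a, j) \<noteq> 0})"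
  have sf: "t i \<in> singleton_free q m k h" if "i < n" for i
    using t that by (auto simp: balanced_tuples_def)
  have row: "4 \<le> (\<Sum>j<k. card (I a j))" if a: "a \<in> T" for a
  proof -
    obtain i where i: "i < n" "a \<in> supp_rows m k (t i)"
      using a by (auto simp: T_def)
    have "2 * 2 \<le> 2 * card (J i a)"
      using card_supp_row_ge_2[OF sf i(2)] i(1) by (simp add: J_def)
    also have "\<dots> = (\<Sum>j\<in>J i a. 2)" by simp
    also have "\<dots> \<le> (\<Sum>j\<in>J i a. card (I a j))"
    proof (rule sum_mono)
      fix j assume j: "j \<in> J i a"
      have "i \<in> I a j" "finite (I a j)" using i j by (auto simp: I_def J_def)
      then have "card (I a j) \<noteq> 0" by auto
      moreover have "card (I a j) \<noteq> 1"
        using t j i by (auto simp: balanced_tuples_def I_def J_def supp_rows_def)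
      ultimately show "2 \<le> card (I a j)" by linarith
    qed
    also have "\<dots> \<le> (\<Sum>j<k. card (I a j))"
      by (intro sum_mono2) (auto simp: J_def)
    finally show ?thesis by simp
  qed
  have "4 * card T = (\<Sum>a\<in>T. 4)" by simp
  also have "\<dots> \<le> (\<Sum>a\<in>T. \<Sum>j<k. card (I a j))"
    using row by (rule sum_mono)
  also have "\<dots> \<le> (\<Sum>a<m. \<Sum>j<k. card (I a j))"
    by (intro sum_mono2) (auto simp: T_def supp_rows_def)
  also have "\<dots> = (\<Sum>a<m. \<Sum>j<k. \<Sum>i<n. if t i (a, j) \<noteq> 0 then 1 else 0)"
    by (simp add: I_def sum.If_cases Int_def)
  also have "\<dots> = (\<Sum>i<n. \<Sum>a<m. \<Sum>j<k. if t i (a, j) \<noteq> 0 then 1 else 0)"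
    by (simp only: sum.swap[of _ "{..<n}"])
  also have "\<dots> = (\<Sum>i<n. wt m k (t i))"
    by (simp add: wt_eq_sum sum.If_cases Int_def)
  also have "\<dots> = n * h"
    using sf by (simp add: singleton_free_def)
  finally show ?thesis by (simp add: T_def)
qed

text \<open>Entries outside the rows in \<open>R\<close> are zero, so such a matrix is determined by
  its restriction to \<open>R\<close>.\<close>

lemma card_supp_rows_subset_le:
  assumes "R \<subseteq> {..<m}"
  shows "card {U \<in> zmats q m k. supp_rows m k U \<subseteq> R} \<le> q ^ (k * card R)"
proof -
  let ?Q = "R \<times> {..<k}"
  have R: "finite R" using assms finite_subset by blast
  have "card {U \<in> zmats q m k. supp_rows m k U \<subseteq> R} \<le> card (?Q \<rightarrow>\<^sub>E {..<q})"
  proof (rule card_inj_on_le[where f = "\<lambda>U. restrict U ?Q"])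
    show "inj_on (\<lambda>U. restrict U ?Q) {U \<in> zmats q m k. supp_rows m k U \<subseteq> R}"
    proof (rule inj_onI)
      fix U V
      assume U: "U \<in> {U \<in> zmats q m k. supp_rows m k U \<subseteq> R}"
        and V: "V \<in> {U \<in> zmats q m k. supp_rows m k U \<subseteq> R}"
        and eq: "restrict U ?Q = restrict V ?Q"
      have "U p = V p" if p: "p \<in> {..<m} \<times> {..<k}" for p
      proof (cases "p \<in> ?Q")
        case True
        then show ?thesis using fun_cong[OF eq, of p] by simp
      next
        case False
        then have "U p = 0" "V p = 0" using U V p by (auto simp: supp_rows_def)
        then show ?thesis by simp
      qed
      then show "U = V"
        using U V unfolding zmats_def
        by (intro PiE_ext[of U "{..<m} \<times> {..<k}" "\<lambda>_. {..<q}" V]) auto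
    qed
    show "(\<lambda>U. restrict U ?Q) ` {U \<in> zmats q m k. supp_rows m k U \<subseteq> R} \<subseteq> ?Q \<rightarrow>\<^sub>E {..<q}"
    proof (rule image_subsetI)
      fix U assume "U \<in> {U \<in> zmats q m k. supp_rows m k U \<subseteq> R}"
      then have "U p \<in> {..<q}" if "p \<in> ?Q" for p
        using assms that zmats_less[of U q m k p] by auto
      then show "restrict U ?Q \<in> ?Q \<rightarrow>\<^sub>E {..<q}"
        unfolding restrict_PiE_iff by blast
    qed
  qed (use R in \<open>auto simp: finite_PiE\<close>)
  then show ?thesis using R by (simp add: card_PiE card_cartesian_product mult.commute)
qed

lemma finite_singleton_free [simp]: "finite (singleton_free q m k h)"
  by (simp add: singleton_free_def)

text \<open>The occupied rows are chosen first, as a subset of \<open>T\<close> of size at most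
  \<open>h / 2\<close>, and then the entries in them. Counting the entries crudely costs only a
  constant factor \<open>q ^ k\<close> for each of the \<open>h\<close> nonzero entries; the
  dependence on \<open>T\<close> comes from the choice of rows.\<close>

lemma card_singleton_free_supported_le:
  fixes z :: real
  assumes q: "q > 0" and T: "T \<subseteq> {..<m}" and z: "0 < z" "z \<le> 1"
  shows "real (card {U \<in> singleton_free q m k h. supp_rows m k U \<subseteq> T}) * z ^ h
      \<le> real q ^ (k * h) * exp (z\<^sup>2 * real (card T))"
proof -
  let ?P = "{R. R \<subseteq> T \<and> 2 * card R \<le> h}"
  have finT: "finite T" using T finite_subset by blast
  have "{U \<in> singleton_free q m k h. supp_rows m k U \<subseteq> T}
      \<subseteq> (\<Union>R\<in>?P. {U \<in> zmats q m k. supp_rows m k U \<subseteq> R})"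
  proof
    fix U assume "U \<in> {U \<in> singleton_free q m k h. supp_rows m k U \<subseteq> T}"
    then have "supp_rows m k U \<in> ?P" "U \<in> zmats q m k"
      using card_supp_rows_le by (auto simp: singleton_free_def)
    then show "U \<in> (\<Union>R\<in>?P. {U \<in> zmats q m k. supp_rows m k U \<subseteq> R})" by blast
  qed
  then have "card {U \<in> singleton_free q m k h. supp_rows m k U \<subseteq> T}
      \<le> card (\<Union>R\<in>?P. {U \<in> zmats q m k. supp_rows m k U \<subseteq> R})"
    using finT by (intro card_mono) auto
  also have "\<dots> \<le> (\<Sum>R\<in>?P. card {U \<in> zmats q m k. supp_rows m k U \<subseteq> R})"
    using finT by (intro card_UN_le) auto
  also have "\<dots> \<le> (\<Sum>R\<in>?P. q ^ (k * h))"
  proof (rule sum_mono)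
    fix R assume "R \<in> ?P"
    then have R: "R \<subseteq> {..<m}" "card R \<le> h" using T by auto
    have "card {U \<in> zmats q m k. supp_rows m k U \<subseteq> R} \<le> q ^ (k * card R)"
      using R by (intro card_supp_rows_subset_le)
    also have "\<dots> \<le> q ^ (k * h)"
      using q R by (intro power_increasing) auto
    finally show "card {U \<in> zmats q m k. supp_rows m k U \<subseteq> R} \<le> q ^ (k * h)" .
  qed
  finally have "card {U \<in> singleton_free q m k h. supp_rows m k U \<subseteq> T} \<le> q ^ (k * h) * card ?P"
    by (simp add: mult.commute)
  then have "real (card {U \<in> singleton_free q m k h. supp_rows m k U \<subseteq> T})
      \<le> real q ^ (k * h) * real (card ?P)"
    by (simp flip: of_nat_mult of_nat_power)
  then have "real (card {U \<in> singleton_free q m k h. supp_rows m k U \<subseteq> T}) * z ^ h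
      \<le> real q ^ (k * h) * real (card ?P) * z ^ h"
    using z by (intro mult_right_mono) auto
  also have "\<dots> = real q ^ (k * h) * (real (card ?P) * z ^ h)" by simp
  also have "\<dots> \<le> real q ^ (k * h) * exp (z\<^sup>2 * real (card T))"
    using card_small_subsets_le[OF finT z] by (intro mult_left_mono) auto
  finally show ?thesis .
qed

text \<open>A tuple is chosen by fixing its set \<open>T\<close> of occupied rows and then selecting
  each matrix independently inside \<open>T\<close>; balance serves only to bound
  \<open>card T\<close>. The weight \<open>z\<close> is adapted to choosing about
  \<open>s * h / 2\<close> rows out of \<open>m\<close>, and \<open>s * h \<le> 2 * m\<close>
  ensures \<open>z \<le> 1\<close>.\<close>

lemma card_balanced_tuples_le:
  fixes q m k h s :: nat
  defines "z \<equiv> sqrt (real (s * h) / (2 * real m))"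
  assumes q: "q > 0" and s: "s > 0" and h: "h > 0" and m: "s * h \<le> 2 * m"
  shows "real (card (balanced_tuples m k (2 * s) (singleton_free q m k h))) * z ^ (s * h)
      \<le> (exp (1 / 2) ^ 3 * real q ^ (2 * k) * real s) ^ (s * h)"
proof -
  define E where "E = exp (1 / 2 :: real)"
  define V where "V = (\<lambda>T. {U \<in> singleton_free q m k h. supp_rows m k U \<subseteq> T})"
  define P where "P = {T. T \<subseteq> {..<m} \<and> 2 * card T \<le> s * h}"
  let ?B = "balanced_tuples m k (2 * s) (singleton_free q m k h)"
  have E: "E ^ n = exp (real n / 2)" for n
    by (simp add: E_def flip: exp_of_nat_mult)
  have mpos: "m > 0" using m s h by (cases m) auto
  have z: "0 < z" "z \<le> 1"
    using s h m mpos by (auto simp: z_def field_simps simp flip: of_nat_mult)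
  have finP: "finite P" by (simp add: P_def)
  have "?B \<subseteq> (\<Union>T\<in>P. {..<2 * s} \<rightarrow>\<^sub>E V T)"
  proof
    fix t assume t: "t \<in> ?B"
    let ?T = "\<Union>i<2 * s. supp_rows m k (t i)"
    have "?T \<in> P"
      using card_Union_supp_rows_le[OF t] supp_rows_subset
      by (auto simp: P_def mult.commute[of s] simp del: UN_simps)
    moreover have "t \<in> {..<2 * s} \<rightarrow>\<^sub>E V ?T"
      using t unfolding balanced_tuples_def V_def PiE_iff by blast
    ultimately show "t \<in> (\<Union>T\<in>P. {..<2 * s} \<rightarrow>\<^sub>E V T)" by blast
  qed
  then have "card ?B \<le> card (\<Union>T\<in>P. {..<2 * s} \<rightarrow>\<^sub>E V T)"
    using finP by (intro card_mono) (auto simp: V_def finite_PiE)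
  also have "\<dots> \<le> (\<Sum>T\<in>P. card ({..<2 * s} \<rightarrow>\<^sub>E V T))"
    using finP by (rule card_UN_le)
  also have "\<dots> = (\<Sum>T\<in>P. card (V T) ^ (2 * s))"
    by (simp add: card_PiE)
  finally have "real (card ?B) \<le> (\<Sum>T\<in>P. real (card (V T)) ^ (2 * s))"
    by (simp flip: of_nat_power of_nat_sum)
  also have "\<dots> \<le> (\<Sum>T\<in>P. ((real q ^ k * E * sqrt (real s)) ^ h) ^ (2 * s))"
  proof (intro sum_mono power_mono)
    fix T assume T: "T \<in> P"
    \<comment> \<open>This weight balances the choice of at most \<open>h / 2\<close> rows against
      \<open>card T \<le> s * h / 2\<close>: the exponent becomes at most \<open>h / 2\<close>, and
      dividing by \<open>?z ^ h\<close> costs \<open>sqrt s\<close> to the power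
      \<open>h\<close>.\<close>
    let ?z = "1 / sqrt (real s)"
    have "real (card (V T)) * ?z ^ h \<le> real q ^ (k * h) * exp (?z\<^sup>2 * real (card T))"
      unfolding V_def using q s T by (intro card_singleton_free_supported_le) (auto simp: P_def)
    also have "\<dots> \<le> real q ^ (k * h) * E ^ h"
    proof -
      have "real (2 * card T) \<le> real (s * h)"
        using T unfolding P_def by (simp only: of_nat_le_iff) simp
      then have "?z\<^sup>2 * real (card T) \<le> real h / 2"
        using s by (simp add: power_divide field_simps)
      then show ?thesis unfolding E by (intro mult_left_mono) auto
    qed
    finally show "real (card (V T)) \<le> (real q ^ k * E * sqrt (real s)) ^ h"
      using s by (simp add: field_simps power_mult_distrib flip: power_mult)
  qed simp
  also have "\<dots> = real (card P) * (real q ^ (2 * k) * E\<^sup>2 * real s) ^ (s * h)"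
  proof -
    have "((real q ^ k * E * sqrt (real s)) ^ h) ^ (2 * s)
        = ((real q ^ k * E * sqrt (real s))\<^sup>2) ^ (s * h)"
      by (simp add: mult_ac flip: power_mult)
    then show ?thesis by (simp add: power_mult_distrib mult.commute flip: power_mult)
  qed
  finally have "real (card ?B) * z ^ (s * h)
      \<le> real (card P) * (real q ^ (2 * k) * E\<^sup>2 * real s) ^ (s * h) * z ^ (s * h)"
    using z by (intro mult_right_mono) auto
  also have "\<dots> = (real (card P) * z ^ (s * h)) * (real q ^ (2 * k) * E\<^sup>2 * real s) ^ (s * h)"
    by simp
  also have "\<dots> \<le> E ^ (s * h) * (real q ^ (2 * k) * E\<^sup>2 * real s) ^ (s * h)"
  proof (intro mult_right_mono)
    have "z\<^sup>2 * real m = real (s * h) / 2"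
      using mpos by (simp add: z_def)
    then have "exp (z\<^sup>2 * real m) = E ^ (s * h)" by (simp add: E)
    then show "real (card P) * z ^ (s * h) \<le> E ^ (s * h)"
      using card_small_subsets_le[of "{..<m}" z "s * h"] z by (simp add: P_def)
  qed (simp add: E_def)
  \<comment> \<open>One factor \<open>E\<close> comes from the choice of \<open>T\<close>, the other
    two from the choice of the \<open>2 * s\<close> matrices.\<close>
  also have "\<dots> = (E ^ 3 * real q ^ (2 * k) * real s) ^ (s * h)"
    by (simp add: power2_eq_square power3_eq_cube mult_ac flip: power_mult_distrib)
  finally show ?thesis by (simp add: E_def)
qed

section \<open>From moments to sums of Fourier coefficients\<close>

text \<open>Jensen's inequality: the values of \<open>w\<close>, divided by the number of matrices,
  are probability weights, and an even power is convex on the whole real line.\<close>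

lemma expect_times_power_le:
  fixes w f :: "zmat \<Rightarrow> real"
  assumes q: "q \<ge> 2" and n: "even n" and w: "\<And>X. w X \<ge> 0" "expect q m k w = 1"
  shows "expect q m k (\<lambda>X. w X * f X) ^ n \<le> expect q m k (\<lambda>X. w X * f X ^ n)"
proof -
  let ?N = "real (card (zmats q m k))"
  have "(\<Sum>X\<in>zmats q m k. w X / ?N) = 1"
    using w(2) by (simp add: expect_def sum_divide_distrib)
  then have "(\<Sum>X\<in>zmats q m k. (w X / ?N) *\<^sub>R f X) ^ n \<le> (\<Sum>X\<in>zmats q m k. (w X / ?N) * f X ^ n)"
    using w(1) zmats_nonempty[OF q]
    by (intro convex_on_sum[OF _ _ convex_power_even[OF n]]) auto
  then show ?thesis by (simp add: expect_def sum_divide_distrib)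
qed

lemma norm_fourier_le: "cmod (fourier q m k g U) \<le> expect q m k (\<lambda>X. cmod (g X))"
  using norm_expect_le[of q m k "\<lambda>X. g X * omega q powi (- int (mat_inner m k U X))"]
  unfolding fourier_def by (simp add: norm_mult del: power_int_minus)

text \<open>Since \<open>|g|\<close> acts as a probability density, the supremum bound
  \<open>M\<close> enters only after Jensen's inequality. It is therefore paid once, and its effect
  after taking the root shrinks as \<open>s\<close> grows.\<close>

lemma sum_fourier_power_le:
  fixes g :: "zmat \<Rightarrow> complex"
  assumes q: "q \<ge> 2" and g1: "expect q m k (\<lambda>X. cmod (g X)) = 1"
    and M: "\<And>X. X \<in> zmats q m k \<Longrightarrow> cmod (g X) \<le> M"
    and S: "S \<subseteq> zmats q m k"
  shows "(\<Sum>U\<in>S. cmod (fourier q m k g U)) ^ (2 * s)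
      \<le> M * real (card (balanced_tuples m k (2 * s) S))"
proof -
  \<comment> \<open>These phases turn each coefficient into its modulus. As
    \<open>sgn 0 = 0\<close>, vanishing coefficients need no separate case, and \<open>c\<close> is
    bounded by 1 rather than unimodular.\<close>
  define c where "c = (\<lambda>U. cnj (sgn (fourier q m k g U)))"
  define F where "F = (\<lambda>X. \<Sum>U\<in>S. c U * omega q powi (- int (mat_inner m k U X)))"
  have c: "cmod (c U) \<le> 1" for U by (simp add: c_def norm_sgn)
  have "M \<ge> 0" using M zmats_nonempty[OF q] norm_ge_zero order_trans by blast
  have "c U * fourier q m k g U = of_real (cmod (fourier q m k g U))" for U
  proof -
    have "c U * fourier q m k g U
        = fourier q m k g U * cnj (fourier q m k g U) / of_real (cmod (fourier q m k g U))"
      by (simp add: c_def sgn_eq)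
    also have "\<dots> = of_real (cmod (fourier q m k g U))"
      by (simp add: power2_eq_square flip: complex_norm_square)
    finally show ?thesis .
  qed
  then have "of_real (\<Sum>U\<in>S. cmod (fourier q m k g U)) = (\<Sum>U\<in>S. c U * fourier q m k g U)"
    by simp
  also have "\<dots> = expect q m k (\<lambda>X. g X * F X)"
    by (simp add: fourier_def expect_def F_def sum_distrib_left sum_divide_distrib
        sum.swap[of _ "zmats q m k"] mult_ac)
  finally have "cmod (of_real (\<Sum>U\<in>S. cmod (fourier q m k g U))) = cmod (expect q m k (\<lambda>X. g X * F X))"
    by (rule arg_cong)
  then have "(\<Sum>U\<in>S. cmod (fourier q m k g U)) = cmod (expect q m k (\<lambda>X. g X * F X))"
    by (simp only: norm_of_real) (simp add: sum_nonneg)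
  also have "\<dots> \<le> expect q m k (\<lambda>X. cmod (g X) * cmod (F X))"
    using norm_expect_le[of q m k "\<lambda>X. g X * F X"] by (simp add: norm_mult)
  finally have "(\<Sum>U\<in>S. cmod (fourier q m k g U)) ^ (2 * s)
      \<le> expect q m k (\<lambda>X. cmod (g X) * cmod (F X)) ^ (2 * s)"
    by (intro power_mono) (auto intro: sum_nonneg)
  also have "\<dots> \<le> expect q m k (\<lambda>X. cmod (g X) * cmod (F X) ^ (2 * s))"
    using q g1 by (intro expect_times_power_le) auto
  also have "\<dots> \<le> expect q m k (\<lambda>X. M * cmod (F X) ^ (2 * s))"
    using M by (intro expect_mono mult_right_mono) auto
  also have "\<dots> = M * expect q m k (\<lambda>X. cmod (F X) ^ (2 * s))"
    by (simp add: expect_def sum_distrib_left)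
  also have "\<dots> \<le> M * real (card (balanced_tuples m k (2 * s) S))"
    using expect_moment_le[of q S m k c s] q S c \<open>M \<ge> 0\<close>
    unfolding F_def by (intro mult_left_mono) auto
  finally show ?thesis .
qed

section \<open>Choice of the moment order\<close>

lemma sum_fourier_singleton_free_le:
  fixes g :: "zmat \<Rightarrow> complex" and \<theta> :: real
  assumes q: "q \<ge> 2" and \<theta>: "\<theta> > 0" and h: "h > 0"
    and g1: "expect q m k (\<lambda>X. cmod (g X)) = 1"
    and M: "\<And>X. X \<in> zmats q m k \<Longrightarrow> cmod (g X) \<le> real q ^ b"
    and hb: "real h < \<theta> * real b" and bm: "(1 + \<theta>) * real b \<le> real m"
  shows "(\<Sum>U\<in>singleton_free q m k h. cmod (fourier q m k g U))
    \<le> sqrt (real q ^ (2 * k + 1) * exp (1 / 2) ^ 3 * sqrt (2 * (1 + \<theta>)) * sqrt (real b * real m) / real h) ^ h"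
proof -
  define L where "L = (\<Sum>U\<in>singleton_free q m k h. cmod (fourier q m k g U))"
  define K where "K = real q ^ (2 * k + 1) * exp (1 / 2) ^ 3"
  \<comment> \<open>Rounding up gives \<open>b \<le> s * h\<close>, so \<open>q ^ b\<close> costs at
    most one factor \<open>q\<close> per unit of the exponent \<open>s * h\<close>. Rounding adds
    less than 1 to \<open>s\<close>, and \<open>h < \<theta> * b\<close> then keeps
    \<open>s * h\<close> below \<open>(1 + \<theta>) * b\<close>.\<close>
  define s where "s = nat \<lceil>real b / real h\<rceil>"
  define z where "z = sqrt (real (s * h) / (2 * real m))"
  define B where "B = real (card (balanced_tuples m k (2 * s) (singleton_free q m k h)))"
  have b: "b > 0" using hb \<theta> h by (cases b) auto
  have m: "m > 0" using bm b \<theta> by (cases m) (auto simp: mult_le_0_iff)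
  have "real s = of_int \<lceil>real b / real h\<rceil>" by (simp add: s_def)
  then have s1: "real b / real h \<le> real s" "real s \<le> real b / real h + 1"
    by linarith+
  then have s: "s > 0" using b h by (cases s) (auto simp: field_simps)
  have bs: "b \<le> s * h"
    using s1(1) h by (simp add: field_simps flip: of_nat_mult)
  have sh: "real s * real h \<le> (1 + \<theta>) * real b"
  proof -
    have "real s * real h \<le> real b + real h" using s1(2) h by (simp add: field_simps)
    then show ?thesis using hb by (simp add: algebra_simps)
  qed
  have shm: "s * h \<le> 2 * m"
  proof -
    have "real (s * h) \<le> real (2 * m)" using sh bm by simp
    then show ?thesis by (simp only: of_nat_le_iff)
  qed
  have z: "z > 0" using s h m by (simp add: z_def)
  \<comment> \<open>As \<open>z\<^sup>2 = s * h / (2 * m)\<close>, the upper bound on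
    \<open>s * h\<close> allows one factor \<open>z\<close> to be split off from \<open>s\<close>.
    Its power then cancels the \<open>z ^ (s * h)\<close> in the tuple count.\<close>
  have sz: "real s \<le> z * (sqrt (2 * (1 + \<theta>)) * sqrt (real b * real m) / real h)"
  proof -
    have "real s * real s * real h \<le> real s * ((1 + \<theta>) * real b)"
      using sh s by simp
    then have "(real s)\<^sup>2 \<le> real s * ((1 + \<theta>) * real b) / real h"
      using h by (simp add: pos_le_divide_eq power2_eq_square)
    also have "\<dots> = (z * (sqrt (2 * (1 + \<theta>)) * sqrt (real b * real m) / real h))\<^sup>2"
    proof -
      have "z\<^sup>2 = real s * real h / (2 * real m)" by (simp add: z_def)
      then show ?thesis
        using m h \<theta> by (simp add: power_mult_distrib power_divide) (simp add: field_simps power2_eq_square)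
    qed
    finally show ?thesis
      using z \<theta> by (intro power2_le_imp_le[of "real s"]) auto
  qed
  have "L ^ (2 * s) \<le> real q ^ b * B"
    unfolding L_def B_def using q g1 M
    by (intro sum_fourier_power_le) (auto simp: singleton_free_def)
  also have "\<dots> \<le> real q ^ (s * h) * B"
    using q bs by (intro mult_right_mono power_increasing) (auto simp: B_def)
  finally have "L ^ (2 * s) * z ^ (s * h) \<le> real q ^ (s * h) * B * z ^ (s * h)"
    using z by (intro mult_right_mono) auto
  also have "\<dots> = real q ^ (s * h) * (B * z ^ (s * h))" by simp
  also have "\<dots> \<le> real q ^ (s * h) * (exp (1 / 2) ^ 3 * real q ^ (2 * k) * real s) ^ (s * h)"
    unfolding B_def z_def using q s h shm
    by (intro mult_left_mono card_balanced_tuples_le) auto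
  \<comment> \<open>In the exponent \<open>2 * k + 1\<close> of \<open>q\<close> inside
    \<open>K\<close>, the part \<open>2 * k\<close> comes from the matrix entries and the 1 from
    \<open>q ^ b \<le> q ^ (s * h)\<close>.\<close>
  also have "\<dots> = (K * real s) ^ (s * h)"
    by (simp add: K_def mult_ac flip: power_mult_distrib)
  also have "\<dots> \<le> (K * (z * (sqrt (2 * (1 + \<theta>)) * sqrt (real b * real m) / real h))) ^ (s * h)"
    using sz by (intro power_mono mult_left_mono) (auto simp: K_def)
  also have "\<dots> = (K * sqrt (2 * (1 + \<theta>)) * sqrt (real b * real m) / real h) ^ (s * h) * z ^ (s * h)"
    by (simp add: field_simps flip: power_mult_distrib)
  finally have "L ^ (2 * s) \<le> (K * sqrt (2 * (1 + \<theta>)) * sqrt (real b * real m) / real h) ^ (s * h)"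
    using z by simp
  \<comment> \<open>Squaring a square root turns the exponent \<open>s * h\<close> into
    \<open>h\<close> times \<open>2 * s\<close>, so that the \<open>2 * s\<close>-th root can be
    taken on both sides.\<close>
  also have "\<dots> = (sqrt (K * sqrt (2 * (1 + \<theta>)) * sqrt (real b * real m) / real h) ^ 2) ^ (s * h)"
    using \<theta> by (subst real_sqrt_pow2) (auto simp: K_def)
  also have "\<dots> = (sqrt (K * sqrt (2 * (1 + \<theta>)) * sqrt (real b * real m) / real h) ^ h) ^ (2 * s)"
    by (simp add: mult_ac flip: power_mult)
  finally show ?thesis
    unfolding L_def K_def using s \<theta> by (subst (asm) power_mono_iff) (auto intro: sum_nonneg)
qed

section \<open>Constants and degenerate cases\<close>

theorem theorem6p1:
  fixes q k :: nat and \<theta> :: real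
  assumes "q \<ge> 2"
  shows "\<exists>\<zeta> \<epsilon>\<^sub>0 :: real. \<zeta> > 0 \<and> \<epsilon>\<^sub>0 > 0 \<and>
    (\<forall>(m::nat) (b::nat) (g :: zmat \<Rightarrow> complex) (h::nat).
       Lp_norm 1 q m k g = 1 \<longrightarrow>
       real h < \<theta> * real b \<longrightarrow>
       log (real q) (Linf_norm q m k g) \<le> real b \<longrightarrow>
       real b \<le> \<epsilon>\<^sub>0 * real k * real m \<longrightarrow>
       (\<Sum>U\<in>singleton_free q m k h. cmod (fourier q m k g U))
         \<le> sqrt (\<zeta> * sqrt (real b * real m) / real h) ^ h)"
proof (cases "\<theta> > 0")
  case False
  \<comment> \<open>For nonpositive \<open>\<theta>\<close> no \<open>h\<close> is admissible, so
    any positive constants serve.\<close>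
  then have "\<not> real h < \<theta> * real b" for h b :: nat
    using mult_nonpos_nonneg[of \<theta> "real b"] by simp
  then show ?thesis by (intro exI[of _ 1]) auto
next
  case True
  define \<zeta> where "\<zeta> = real q ^ (2 * k + 1) * exp (1 / 2) ^ 3 * sqrt (2 * (1 + \<theta>))"
  \<comment> \<open>Using \<open>k + 1\<close> in place of \<open>k\<close> keeps the constant
    meaningful at \<open>k = 0\<close>, and the hypothesis on \<open>b\<close> still yields
    \<open>(1 + \<theta>) * b \<le> m\<close>.\<close>
  define \<epsilon> where "\<epsilon> = 1 / ((1 + \<theta>) * (real k + 1))"
  have "(\<Sum>U\<in>singleton_free q m k h. cmod (fourier q m k g U))
         \<le> sqrt (\<zeta> * sqrt (real b * real m) / real h) ^ h"
    if g: "Lp_norm 1 q m k g = 1" and hb: "real h < \<theta> * real b"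
      and M: "log (real q) (Linf_norm q m k g) \<le> real b" and bm: "real b \<le> \<epsilon> * real k * real m"
    for m b h and g :: "zmat \<Rightarrow> complex"
  proof -
    have "expect q m k (\<lambda>X. cmod (g X)) \<ge> 0"
      by (simp add: expect_def sum_nonneg)
    then have g1: "expect q m k (\<lambda>X. cmod (g X)) = 1"
      using g by (simp add: Lp_norm_def)
    have le_Linf: "cmod (g X) \<le> Linf_norm q m k g" if "X \<in> zmats q m k" for X
      using that by (simp add: Linf_norm_def)
    \<comment> \<open>Positivity of the supremum norm is what lets the logarithmic hypothesis be
      exponentiated; it holds because \<open>|g|\<close> has mean 1 and so \<open>g\<close> is not
      identically zero.\<close>
    obtain X where X: "X \<in> zmats q m k" "g X \<noteq> 0"
      using g1 by (force simp: expect_def)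
    then have "Linf_norm q m k g > 0"
      using le_Linf[of X] by (meson less_le_trans zero_less_norm_iff)
    then have Linf: "Linf_norm q m k g \<le> real q ^ b"
      using M assms by (simp add: log_le_iff powr_realpow)
    show ?thesis
    proof (cases "h = 0")
      case True
      \<comment> \<open>At \<open>h = 0\<close> the right side is an empty power, equal to 1. Only
        the zero matrix has weight 0, and any Fourier coefficient is at most the mean of
        \<open>|g|\<close>.\<close>
      have "singleton_free q m k 0 \<subseteq> {\<lambda>p\<in>{..<m} \<times> {..<k}. 0}"
      proof
        fix U assume U: "U \<in> singleton_free q m k 0"
        have "finite {(i, j). i < m \<and> j < k \<and> U (i, j) \<noteq> 0}"
          by (rule finite_subset[of _ "{..<m} \<times> {..<k}"]) auto
        then have "U p = 0" if "p \<in> {..<m} \<times> {..<k}" for p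
          using U that by (auto simp: singleton_free_def wt_def)
        moreover have "U p = undefined" if "p \<notin> {..<m} \<times> {..<k}" for p
          using U that by (auto simp: singleton_free_def zmats_def dest: PiE_arb)
        ultimately show "U \<in> {\<lambda>p\<in>{..<m} \<times> {..<k}. 0}"
          by (auto simp: restrict_def fun_eq_iff)
      qed
      then have "(\<Sum>U\<in>singleton_free q m k 0. cmod (fourier q m k g U))
          \<le> (\<Sum>U\<in>{\<lambda>p\<in>{..<m} \<times> {..<k}. 0}. cmod (fourier q m k g U))"
        by (intro sum_mono2) auto
      also have "\<dots> \<le> 1"
        using norm_fourier_le[of q m k g] g1 by simp
      finally show ?thesis using True by simp
    next
      case False
      have "(1 + \<theta>) * real b \<le> (1 + \<theta>) * (\<epsilon> * real k * real m)"
        using bm True by (intro mult_left_mono) auto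
      also have "\<dots> = (real k / (real k + 1)) * real m"
        using True by (simp add: \<epsilon>_def)
      also have "\<dots> \<le> real m"
        by (intro mult_left_le_one_le) auto
      finally have "(1 + \<theta>) * real b \<le> real m" .
      then show ?thesis
        unfolding \<zeta>_def using False assms True g1 hb le_Linf Linf
        by (intro sum_fourier_singleton_free_le) (auto intro: order_trans)
    qed
  qed
  moreover have "\<zeta> > 0" "\<epsilon> > 0" using assms True by (auto simp: \<zeta>_def \<epsilon>_def)
  ultimately show ?thesis by blast
qed

end
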